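(* If $\lambda\in C_3$, then $t_{\mathrm{cut}}(\lambda)=t^1_{\mathrm{conj}}(\lambda)=t^1_{\mathrm{MAX}}(\lambda)=+\infty$.
   Context: Let $G=\mathbb R^5$ with coordinates $(x,y,z,v,w)$ (the Cartan group, identity $0$), vector fields $X_1=\partial_x-\frac y2\partial_z-\frac{x^2+y^2}{2}\partial_w$, $X_2=\partial_y+\frac x2\partial_z+\frac{x^2+y^2}{2}\partial_v$; sub-Riemannian problem $\dot g=u_1X_1+u_2X_2$, fixed endpoints, minimize $\int\sqrt{u_1^2+u_2^2}\,dt$. For $\lambda=(\theta,c,\alpha,\beta)$, $\theta,\beta\in S^1$, $c\in\mathbb R$, $\alpha\ge0$: $\mathrm{Exp}(\lambda,t)=g(t)$ with $g(0)=0$, $\dot g=\cos\theta(t)X_1+\sin\theta(t)X_2$, $\dot\theta=c$, $\dot c=-\alpha\sin(\theta-\beta)$, $(\theta(0),c(0))=(\theta,c)$. $E=\frac{c^2}2-\alpha\cos(\theta-\beta)$; $C_3=\{\alpha>0,\ E=\alpha,\ \theta-\beta\ne\pi\}$. $t_{\mathrm{cut}}(\lambda)=\sup\{t>0:\mathrm{Exp}(\lambda,\cdot)|_{[0,t]}\text{ is length minimizing}\}$; $t^1_{\mathrm{conj}}(\lambda)=\sup\{t>0:\mathrm{Exp}(\lambda,\cdot)|_{[0,t]}\text{ is locally optimal}\}$ (minimizing among admissible curves with same endpoints in a $C([0,t],G)$-neighborhood). The first Maxwell time $t^1_{\mathrm{MAX}}$ is defined to be $+\infty$ on $C_3$. 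*)

theory Defs
  imports "HOL-Analysis.Analysis"
begin

text \<open>Points of the Cartan group G = R^5, coordinates (x,y,z,v,w).\<close>
type_synonym pt = "real \<times> real \<times> real \<times> real \<times> real"

definition X1 :: "pt \<Rightarrow> pt" where
  "X1 p = (case p of (x,y,z,v,w) \<Rightarrow> (1, 0, - y/2, 0, - (x^2+y^2)/2))"

definition X2 :: "pt \<Rightarrow> pt" where
  "X2 p = (case p of (x,y,z,v,w) \<Rightarrow> (0, 1, x/2, (x^2+y^2)/2, 0))"

definition admissible :: "real \<Rightarrow> (real \<Rightarrow> pt) \<Rightarrow> (real \<Rightarrow> real) \<Rightarrow> (real \<Rightarrow> real) \<Rightarrow> bool" where
  "admissible T h v1 v2 \<longleftrightarrow> 0 \<le> T \<and>
     v1 measurable_on {0..T} \<and> v2 measurable_on {0..T} \<and>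
     bounded (v1 ` {0..T}) \<and> bounded (v2 ` {0..T}) \<and>
     continuous_on {0..T} h \<and>
     (\<lambda>s. v1 s *\<^sub>R X1 (h s) + v2 s *\<^sub>R X2 (h s)) integrable_on {0..T} \<and>
     (\<forall>t\<in>{0..T}. h t = h 0 + integral {0..t} (\<lambda>s. v1 s *\<^sub>R X1 (h s) + v2 s *\<^sub>R X2 (h s)))"

definition sr_length :: "real \<Rightarrow> (real \<Rightarrow> real) \<Rightarrow> (real \<Rightarrow> real) \<Rightarrow> real" where
  "sr_length T v1 v2 = integral {0..T} (\<lambda>s. sqrt ((v1 s)^2 + (v2 s)^2))"

definition minimizing :: "(real \<Rightarrow> pt) \<Rightarrow> (real \<Rightarrow> real) \<Rightarrow> (real \<Rightarrow> real) \<Rightarrow> real \<Rightarrow> bool" where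
  "minimizing g u1 u2 T \<longleftrightarrow> admissible T g u1 u2 \<and>
     (\<forall>T' h v1 v2. admissible T' h v1 v2 \<and> h 0 = g 0 \<and> h T' = g T \<longrightarrow>
        sr_length T u1 u2 \<le> sr_length T' v1 v2)"

definition locally_optimal :: "(real \<Rightarrow> pt) \<Rightarrow> (real \<Rightarrow> real) \<Rightarrow> (real \<Rightarrow> real) \<Rightarrow> real \<Rightarrow> bool" where
  "locally_optimal g u1 u2 T \<longleftrightarrow> admissible T g u1 u2 \<and>
     (\<exists>\<epsilon>>0. \<forall>h v1 v2. admissible T h v1 v2 \<and> h 0 = g 0 \<and> h T = g T \<and>
        (\<forall>s\<in>{0..T}. dist (h s) (g s) < \<epsilon>) \<longrightarrow>
        sr_length T u1 u2 \<le> sr_length T v1 v2)"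

text \<open>(th, c, g) is the solution of the Hamiltonian system defining Exp(lambda, t),
  lambda = (theta0, c0, alpha, beta).\<close>
definition extremal :: "real \<Rightarrow> real \<Rightarrow> real \<Rightarrow> real \<Rightarrow>
    (real \<Rightarrow> real) \<Rightarrow> (real \<Rightarrow> real) \<Rightarrow> (real \<Rightarrow> pt) \<Rightarrow> bool" where
  "extremal \<theta>0 c0 \<alpha> \<beta> th c g \<longleftrightarrow>
     th 0 = \<theta>0 \<and> c 0 = c0 \<and> g 0 = 0 \<and>
     (\<forall>t. (th has_real_derivative c t) (at t)) \<and>
     (\<forall>t. (c has_real_derivative (- \<alpha> * sin (th t - \<beta>))) (at t)) \<and>
     (\<forall>t. (g has_vector_derivative (cos (th t) *\<^sub>R X1 (g t) + sin (th t) *\<^sub>R X2 (g t))) (at t))"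

definition in_C3 :: "real \<Rightarrow> real \<Rightarrow> real \<Rightarrow> real \<Rightarrow> bool" where
  "in_C3 \<theta> c \<alpha> \<beta> \<longleftrightarrow> \<alpha> > 0 \<and> c^2/2 - \<alpha> * cos (\<theta> - \<beta>) = \<alpha> \<and>
     (\<forall>k::int. \<theta> - \<beta> \<noteq> pi + 2 * pi * of_int k)"

definition t_cut :: "(real \<Rightarrow> real) \<Rightarrow> (real \<Rightarrow> pt) \<Rightarrow> ereal" where
  "t_cut th g = Sup {ereal t | t. 0 < t \<and> minimizing g (\<lambda>s. cos (th s)) (\<lambda>s. sin (th s)) t}"

definition t_conj1 :: "(real \<Rightarrow> real) \<Rightarrow> (real \<Rightarrow> pt) \<Rightarrow> ereal" where
  "t_conj1 th g = Sup {ereal t | t. 0 < t \<and> locally_optimal g (\<lambda>s. cos (th s)) (\<lambda>s. sin (th s)) t}"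

text \<open>First Maxwell time: by convention +infinity on C3 (other strata not needed here).\<close>
definition t_MAX1 :: "real \<Rightarrow> real \<Rightarrow> real \<Rightarrow> real \<Rightarrow> ereal" where
  "t_MAX1 \<theta> c \<alpha> \<beta> = (if in_C3 \<theta> c \<alpha> \<beta> then \<infinity> else undefined)"

end

theory Submission
  imports Defs
begin

text \<open>The curvature of an extremal is an affine function of its planar projection. In planar coordinates
  adapted to it (the rescaled Euler soliton, asymptotic to the line \<open>x = 0\<close>), the horizontal lift
  determines \<open>u = - \<integral> x\<^sup>2 dy\<close>. Let \<open>e\<close> be the running excess of length over the increment of \<open>y\<close>,
  with initial value read off the soliton. The function
  \<open>R(e, x, u) = e\<^sup>3 + 6 x\<^sup>2 e - 24 u - 3 x\<^sup>4 / e\<close> vanishes identically along the soliton, is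
  nondecreasing along every horizontal curve (a pointwise Cauchy--Schwarz inequality), and is
  strictly increasing in \<open>e > 0\<close>. Hence a competitor with the same endpoints cannot end with a
  smaller excess, and the soliton is minimizing on every interval.\<close>

section \<open>Indefinite integrals of bounded measurable functions\<close>

definition bounded_measurable :: "real \<Rightarrow> (real \<Rightarrow> real) \<Rightarrow> bool" where
  "bounded_measurable T f \<longleftrightarrow> f \<in> borel_measurable (lebesgue_on {0..T}) \<and> bounded (f ` {0..T})"

text \<open>Controls of a competitor are only bounded and measurable, so its coordinates are
  Lipschitz but need not be differentiable everywhere. Recording \<open>F\<close> as an indefinite
  integral of a rate \<open>f\<close> with a value at every point avoids null sets: sign conditions
  on rates can be checked pointwise.\<close>

definition bounded_primitive :: "real \<Rightarrow> (real \<Rightarrow> real) \<Rightarrow> (real \<Rightarrow> real) \<Rightarrow> bool" where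
  "bounded_primitive T F f \<longleftrightarrow> bounded_measurable T f \<and>
     (\<forall>t\<in>{0..T}. (f has_integral F t - F 0) {0..t})"

lemma bounded_measurable_obtain:
  assumes "bounded_measurable T f"
  obtains M where "M > 0" "\<And>t. t \<in> {0..T} \<Longrightarrow> \<bar>f t\<bar> \<le> M"
  using assms by (auto simp: bounded_measurable_def bounded_pos)

lemma bounded_measurableI:
  assumes "f \<in> borel_measurable (lebesgue_on {0..T})" "\<And>t. t \<in> {0..T} \<Longrightarrow> \<bar>f t\<bar> \<le> M"
  shows "bounded_measurable T f"
  using assms unfolding bounded_measurable_def bounded_iff by force

lemma bounded_measurable_add:
  assumes "bounded_measurable T f" "bounded_measurable T g"
  shows "bounded_measurable T (\<lambda>t. f t + g t)"
  using assms unfolding bounded_measurable_def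
  by (auto intro!: borel_measurable_add bounded_plus_comp simp: image_image)

lemma bounded_measurable_continuous:
  assumes "continuous_on {0..T} f"
  shows "bounded_measurable T f"
  using assms unfolding bounded_measurable_def
  by (auto intro!: continuous_imp_measurable_on_sets_lebesgue compact_imp_bounded
      compact_continuous_image)

lemma bounded_measurable_mult:
  assumes "bounded_measurable T f" "bounded_measurable T g"
  shows "bounded_measurable T (\<lambda>t. f t * g t)"
proof -
  obtain M N where M: "M > 0" "\<And>t. t \<in> {0..T} \<Longrightarrow> \<bar>f t\<bar> \<le> M"
    and N: "N > 0" "\<And>t. t \<in> {0..T} \<Longrightarrow> \<bar>g t\<bar> \<le> N"
    using assms by (metis bounded_measurable_obtain)
  show ?thesis
  proof (rule bounded_measurableI[where M = "M * N"])
    show "(\<lambda>t. f t * g t) \<in> borel_measurable (lebesgue_on {0..T})"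
      using assms by (auto simp: bounded_measurable_def)
    show "\<bar>f t * g t\<bar> \<le> M * N" if "t \<in> {0..T}" for t
      using M N that by (auto simp: abs_mult intro!: mult_mono)
  qed
qed

lemma bounded_measurable_integrable:
  assumes "bounded_measurable T f" "t \<le> T"
  shows "f integrable_on {0..t}"
proof -
  obtain M where M: "\<And>t. t \<in> {0..T} \<Longrightarrow> \<bar>f t\<bar> \<le> M"
    using assms by (metis bounded_measurable_obtain)
  have "f integrable_on {0..T}"
  proof (rule measurable_bounded_by_integrable_imp_integrable_real)
    show "(\<lambda>_. M) integrable_on {0..T}"
      by (rule integrable_const_ivl)
  qed (use assms M in \<open>auto simp: bounded_measurable_def\<close>)
  then show ?thesis
    by (rule integrable_on_subinterval) (use assms in auto)
qed

lemma bounded_primitive_integral: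
  assumes "bounded_measurable T f"
  shows "bounded_primitive T (\<lambda>t. integral {0..t} f) f"
  unfolding bounded_primitive_def
  using bounded_measurable_integrable[OF assms] assms by (auto simp: has_integral_integral)

lemma bounded_primitive_cong:
  assumes "bounded_primitive T F f" "\<And>t. t \<in> {0..T} \<Longrightarrow> F t = G t" "\<And>t. f t = g t"
  shows "bounded_primitive T G g"
proof -
  have "f = g" using assms(3) by auto
  moreover have "G t - G 0 = F t - F 0" if "t \<in> {0..T}" for t
    using assms(2)[of t] assms(2)[of 0] that by auto
  ultimately show ?thesis
    using assms(1) unfolding bounded_primitive_def by auto
qed

lemma bounded_primitive_const: "bounded_primitive T (\<lambda>_. c) (\<lambda>_. 0)"
  by (auto simp: bounded_primitive_def bounded_measurable_def bounded_iff)

lemma bounded_primitive_add: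
  assumes "bounded_primitive T F f" "bounded_primitive T G g"
  shows "bounded_primitive T (\<lambda>t. F t + G t) (\<lambda>t. f t + g t)"
  using assms unfolding bounded_primitive_def
  by (auto intro!: bounded_measurable_add simp: add_diff_add has_integral_add)

lemma bounded_primitive_cmult:
  assumes "bounded_primitive T F f"
  shows "bounded_primitive T (\<lambda>t. c * F t) (\<lambda>t. c * f t)"
proof -
  have "bounded_measurable T (\<lambda>t. c * f t)"
    using assms bounded_measurable_mult[OF bounded_measurable_continuous[of T "\<lambda>_. c"]]
    by (simp add: bounded_primitive_def)
  moreover have "((\<lambda>t. c * f t) has_integral c * F t - c * F 0) {0..t}" if "t \<in> {0..T}" for t
    using assms that has_integral_mult_right[of f "F t - F 0" "{0..t}" c]
    by (auto simp: bounded_primitive_def right_diff_distrib)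
  ultimately show ?thesis
    by (simp add: bounded_primitive_def)
qed

lemma bounded_primitive_diff:
  assumes "bounded_primitive T F f" "bounded_primitive T G g"
  shows "bounded_primitive T (\<lambda>t. F t - G t) (\<lambda>t. f t - g t)"
  using bounded_primitive_add[OF assms(1) bounded_primitive_cmult[OF assms(2), of "-1"]] by simp

lemma bounded_primitive_has_integral:
  assumes "bounded_primitive T F f" "0 \<le> s" "s \<le> t" "t \<le> T"
  shows "(f has_integral F t - F s) {s..t}"
proof -
  have i: "f integrable_on {s..t}"
    by (rule integrable_on_subinterval[OF bounded_measurable_integrable[of T f T]])
      (use assms in \<open>auto simp: bounded_primitive_def\<close>)
  have "(f has_integral (F s - F 0) + integral {s..t} f) {0..t}"
    by (rule has_integral_combine[of _ s])
      (use assms i in \<open>auto simp: bounded_primitive_def has_integral_integral\<close>)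
  moreover have "(f has_integral F t - F 0) {0..t}"
    using assms by (auto simp: bounded_primitive_def)
  ultimately have "(F s - F 0) + integral {s..t} f = F t - F 0"
    by (rule has_integral_unique)
  then have "integral {s..t} f = F t - F s"
    by linarith
  with integrable_integral[OF i] show ?thesis
    by simp
qed

text \<open>The bound is asked for only within distance \<open>\<bar>t - s\<bar>\<close> of
  \<open>s\<close>, on either side, so \<open>K\<close> may be chosen small when \<open>t\<close> is
  near \<open>s\<close>. The chain rule relies on this local form.\<close>

lemma bounded_primitive_increment:
  assumes "bounded_primitive T F f" "s \<in> {0..T}" "t \<in> {0..T}" "0 \<le> K"
    and "\<And>r. r \<in> {0..T} \<Longrightarrow> \<bar>r - s\<bar> \<le> \<bar>t - s\<bar> \<Longrightarrow> \<bar>f r\<bar> \<le> K"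
  shows "\<bar>F t - F s\<bar> \<le> K * \<bar>t - s\<bar>"
proof (cases "s \<le> t")
  case True
  then show ?thesis
    using has_integral_bound_real[of K "{}" f "F t - F s" s t] assms
      bounded_primitive_has_integral[OF assms(1), of s t] by auto
next
  case False
  then show ?thesis
    using has_integral_bound_real[of K "{}" f "F s - F t" t s] assms
      bounded_primitive_has_integral[OF assms(1), of t s] by auto
qed

lemma bounded_primitive_lipschitz:
  assumes "bounded_primitive T F f"
  obtains M where "M > 0" "\<And>t. t \<in> {0..T} \<Longrightarrow> \<bar>f t\<bar> \<le> M"
    "\<And>s t. s \<in> {0..T} \<Longrightarrow> t \<in> {0..T} \<Longrightarrow> \<bar>F t - F s\<bar> \<le> M * \<bar>t - s\<bar>"
proof -
  obtain M where M: "M > 0" "\<And>t. t \<in> {0..T} \<Longrightarrow> \<bar>f t\<bar> \<le> M"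
    using assms bounded_measurable_obtain unfolding bounded_primitive_def by metis
  with bounded_primitive_increment[OF assms, where K = M] show ?thesis
    by (intro that[of M]) auto
qed

lemma bounded_primitive_continuous:
  assumes "bounded_primitive T F f"
  shows "continuous_on {0..T} F"
proof -
  obtain M where "M > 0" and M: "\<And>s t. s \<in> {0..T} \<Longrightarrow> t \<in> {0..T} \<Longrightarrow> \<bar>F t - F s\<bar> \<le> M * \<bar>t - s\<bar>"
    using assms by (rule bounded_primitive_lipschitz) blast
  then have "M-lipschitz_on {0..T} F"
    by (intro lipschitz_onI) (auto simp: dist_real_def)
  then show ?thesis
    by (rule lipschitz_on_continuous_on)
qed

lemma bounded_primitive_mono:
  assumes "bounded_primitive T F f" "0 \<le> s" "s \<le> t" "t \<le> T"
    and "\<And>r. r \<in> {0..T} \<Longrightarrow> 0 \<le> f r"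
  shows "F s \<le> F t"
  using has_integral_nonneg[OF bounded_primitive_has_integral[OF assms(1-4)]] assms by auto

text \<open>This later identifies the calibrating coordinates along the extremal with closed
  formulas: both have the same rate and the same initial value.\<close>

lemma bounded_primitive_unique:
  assumes F: "bounded_primitive T F f" and G: "bounded_primitive T G g"
    and "\<And>r. r \<in> {0..T} \<Longrightarrow> f r = g r" "F 0 = G 0" "t \<in> {0..T}"
  shows "F t = G t"
proof -
  have "(f has_integral F t - F 0) {0..t}"
    using F assms(5) by (simp add: bounded_primitive_def)
  then have "(g has_integral F t - F 0) {0..t}"
    by (rule has_integral_eq[rotated]) (use assms(3,5) in auto)
  moreover have "(g has_integral G t - G 0) {0..t}"
    using G assms(5) by (simp add: bounded_primitive_def)
  ultimately have "F t - F 0 = G t - G 0"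
    by (rule has_integral_unique)
  with assms(4) show ?thesis
    by simp
qed

lemma bounded_primitive_deriv:
  assumes "\<And>t. t \<in> {0..T} \<Longrightarrow> (F has_real_derivative f t) (at t)" "continuous_on {0..T} f"
  shows "bounded_primitive T F f"
  unfolding bounded_primitive_def
proof (intro conjI ballI)
  show "bounded_measurable T f"
    using assms(2) by (rule bounded_measurable_continuous)
  fix t assume t: "t \<in> {0..T}"
  show "(f has_integral F t - F 0) {0..t}"
  proof (rule fundamental_theorem_of_calculus)
    show "(F has_vector_derivative f r) (at r within {0..t})" if "r \<in> {0..t}" for r
      using assms(1)[of r] that t
      by (auto simp flip: has_real_derivative_iff_has_vector_derivative
          intro: has_field_derivative_at_within)
  qed (use t in simp)
qed

text \<open>The indefinite integrals are only differentiable almost everywhere, but their difference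
  from the composition has derivative zero everywhere, because at every point both sides have the
  same first-order increment.\<close>

lemma bounded_primitive_chain:
  assumes F: "bounded_primitive T F f"
    and deriv: "\<And>t. t \<in> {0..T} \<Longrightarrow> (\<psi> has_real_derivative \<psi>' (F t)) (at (F t))"
    and cont: "continuous_on {0..T} (\<lambda>t. \<psi>' (F t))"
  shows "bounded_primitive T (\<lambda>t. \<psi> (F t)) (\<lambda>t. \<psi>' (F t) * f t)"
proof -
  have bm: "bounded_measurable T (\<lambda>t. \<psi>' (F t) * f t)"
    using F cont bounded_measurable_continuous bounded_measurable_mult bounded_primitive_def by auto
  define I where "I = (\<lambda>t. integral {0..t} (\<lambda>t. \<psi>' (F t) * f t))"
  have I: "bounded_primitive T I (\<lambda>t. \<psi>' (F t) * f t)"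
    unfolding I_def by (rule bounded_primitive_integral[OF bm])
  obtain M where M: "M > 0" "\<And>t. t \<in> {0..T} \<Longrightarrow> \<bar>f t\<bar> \<le> M"
    "\<And>s t. s \<in> {0..T} \<Longrightarrow> t \<in> {0..T} \<Longrightarrow> \<bar>F t - F s\<bar> \<le> M * \<bar>t - s\<bar>"
    using F by (rule bounded_primitive_lipschitz) blast
  have zero: "((\<lambda>t. \<psi> (F t) - I t) has_real_derivative 0) (at s within {0..T})"
    if s: "s \<in> {0..T}" for s
    unfolding has_field_derivative_def has_derivative_within_alt
  proof (intro conjI allI impI)
    show "bounded_linear ((*) (0::real))" by (simp add: bounded_linear_mult_right)
    fix \<epsilon> :: real assume "\<epsilon> > 0"
    \<comment> \<open>\<open>M\<close> bounds the rate and is also a Lipschitz constant of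
      \<open>F\<close>; this tolerance makes each of the two errors \<open>A\<close> and
      \<open>B\<close> below at most half of the allowed one.\<close>
    define \<eta> where "\<eta> = \<epsilon> / (2 * M)"
    have \<eta>: "\<eta> > 0" "\<eta> * M = \<epsilon> / 2"
      using \<open>\<epsilon> > 0\<close> M(1) by (auto simp: \<eta>_def)
    obtain d1 where d1: "d1 > 0"
      "\<And>y. \<bar>y - F s\<bar> < d1 \<Longrightarrow> \<bar>\<psi> y - \<psi> (F s) - \<psi>' (F s) * (y - F s)\<bar> \<le> \<eta> * \<bar>y - F s\<bar>"
      using deriv[OF s] \<eta>(1) unfolding has_field_derivative_def has_derivative_at_alt
      by (force simp: real_norm_def)
    obtain d2 where d2: "d2 > 0"
      "\<And>r. r \<in> {0..T} \<Longrightarrow> \<bar>r - s\<bar> < d2 \<Longrightarrow> \<bar>\<psi>' (F r) - \<psi>' (F s)\<bar> < \<eta>"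
      using cont s \<eta>(1) unfolding continuous_on_iff dist_real_def by (metis abs_minus_commute)
    show "\<exists>d>0. \<forall>t\<in>{0..T}. norm (t - s) < d \<longrightarrow>
        norm (\<psi> (F t) - I t - (\<psi> (F s) - I s) - 0 * (t - s)) \<le> \<epsilon> * norm (t - s)"
    proof (intro exI[of _ "min (d1 / M) d2"] conjI ballI impI)
      show "0 < min (d1 / M) d2" using d1 d2 M by auto
      fix t assume t: "t \<in> {0..T}" and "norm (t - s) < min (d1 / M) d2"
      then have close: "M * \<bar>t - s\<bar> < d1" "\<bar>t - s\<bar> < d2"
        using M(1) by (auto simp: pos_less_divide_eq mult.commute)
      have "\<bar>\<psi> (F t) - \<psi> (F s) - \<psi>' (F s) * (F t - F s)\<bar> \<le> \<eta> * \<bar>F t - F s\<bar>"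
        using d1(2) M(3)[OF s t] close(1) by auto
      also have "\<dots> \<le> \<eta> * (M * \<bar>t - s\<bar>)"
        using \<eta>(1) M(3)[OF s t] by (simp add: mult_left_mono)
      finally have A: "\<bar>\<psi> (F t) - \<psi> (F s) - \<psi>' (F s) * (F t - F s)\<bar> \<le> \<epsilon> / 2 * \<bar>t - s\<bar>"
        using \<eta>(2) by (metis mult.assoc)
      \<comment> \<open>Freezing the factor \<open>\<psi>'\<close> at \<open>F s\<close> leaves a
        primitive whose rate is \<open>(\<psi>' (F r) - \<psi>' (F s)) * f r\<close>, which is small
        near \<open>s\<close> by continuity.\<close>
      have "bounded_primitive T (\<lambda>t. I t - \<psi>' (F s) * F t) (\<lambda>t. \<psi>' (F t) * f t - \<psi>' (F s) * f t)"
        by (intro bounded_primitive_diff I bounded_primitive_cmult F)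
      moreover have "\<bar>\<psi>' (F r) * f r - \<psi>' (F s) * f r\<bar> \<le> \<eta> * M"
        if "r \<in> {0..T}" "\<bar>r - s\<bar> \<le> \<bar>t - s\<bar>" for r
        using d2(2)[of r] M(2)[of r] that close(2) \<eta>(1)
        by (auto simp: abs_mult simp flip: left_diff_distrib intro!: mult_mono)
      ultimately have B: "\<bar>I t - \<psi>' (F s) * F t - (I s - \<psi>' (F s) * F s)\<bar> \<le> \<epsilon> / 2 * \<bar>t - s\<bar>"
        using bounded_primitive_increment[OF _ s t, of _ _ "\<epsilon> / 2"] \<open>\<epsilon> > 0\<close> \<eta>(2) by auto
      have "\<bar>\<psi> (F t) - I t - (\<psi> (F s) - I s)\<bar> \<le> \<epsilon> / 2 * \<bar>t - s\<bar> + \<epsilon> / 2 * \<bar>t - s\<bar>"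
        using A B unfolding right_diff_distrib by arith
      then show "norm (\<psi> (F t) - I t - (\<psi> (F s) - I s) - 0 * (t - s)) \<le> \<epsilon> * norm (t - s)"
        by simp
    qed
  qed
  have "\<exists>c. \<forall>t\<in>{0..T}. \<psi> (F t) - I t = c"
    by (rule has_field_derivative_zero_constant) (use zero in auto)
  then obtain c where c: "\<And>t. t \<in> {0..T} \<Longrightarrow> \<psi> (F t) - I t = c" by auto
  have "bounded_primitive T (\<lambda>t. I t + c) (\<lambda>t. \<psi>' (F t) * f t)"
    using bounded_primitive_add[OF I bounded_primitive_const] by simp
  then show ?thesis
    by (rule bounded_primitive_cong) (use c in \<open>auto simp: algebra_simps\<close>)
qed

lemma bounded_primitive_power:
  assumes "bounded_primitive T F f"
  shows "bounded_primitive T (\<lambda>t. F t ^ n) (\<lambda>t. of_nat n * F t ^ (n - 1) * f t)"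
proof (rule bounded_primitive_chain[OF assms, where \<psi> = "\<lambda>y. y ^ n" and \<psi>' = "\<lambda>y. of_nat n * y ^ (n - 1)"])
  show "((\<lambda>y. y ^ n) has_real_derivative of_nat n * F t ^ (n - 1)) (at (F t))" for t
    by (auto intro!: derivative_eq_intros)
  show "continuous_on {0..T} (\<lambda>t. of_nat n * F t ^ (n - 1))"
    by (intro continuous_intros bounded_primitive_continuous[OF assms])
qed

lemma bounded_primitive_inverse:
  assumes "bounded_primitive T F f" "\<And>t. t \<in> {0..T} \<Longrightarrow> F t \<noteq> 0"
  shows "bounded_primitive T (\<lambda>t. 1 / F t) (\<lambda>t. - 1 / F t ^ 2 * f t)"
proof (rule bounded_primitive_chain[OF assms(1), where \<psi> = "\<lambda>y. 1 / y" and \<psi>' = "\<lambda>y. - 1 / y ^ 2"])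
  show "((\<lambda>y. 1 / y) has_real_derivative - 1 / F t ^ 2) (at (F t))" if "t \<in> {0..T}" for t
    using assms(2)[OF that]
    by (auto intro!: derivative_eq_intros simp: power2_eq_square)
  show "continuous_on {0..T} (\<lambda>t. - 1 / F t ^ 2)"
    by (intro continuous_intros bounded_primitive_continuous[OF assms(1)]) (use assms(2) in auto)
qed

text \<open>Polarization expresses the product by squares of the sum and the difference, so the
  chain rule in one variable suffices.\<close>

lemma bounded_primitive_mult:
  assumes "bounded_primitive T F f" "bounded_primitive T G g"
  shows "bounded_primitive T (\<lambda>t. F t * G t) (\<lambda>t. F t * g t + f t * G t)"
proof (rule bounded_primitive_cong)
  have sq: "bounded_primitive T (\<lambda>t. H t ^ 2) (\<lambda>t. 2 * H t * h t)" if "bounded_primitive T H h" for H h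
    using bounded_primitive_power[OF that, of 2] by simp
  show "bounded_primitive T (\<lambda>t. 1/4 * ((F t + G t)^2 - (F t - G t)^2))
      (\<lambda>t. 1/4 * (2 * (F t + G t) * (f t + g t) - 2 * (F t - G t) * (f t - g t)))"
    by (rule bounded_primitive_cmult bounded_primitive_diff sq bounded_primitive_add assms)+
  show "1/4 * ((F t + G t)^2 - (F t - G t)^2) = F t * G t" for t
    by (simp add: power2_eq_square algebra_simps)
  show "1/4 * (2 * (F t + G t) * (f t + g t) - 2 * (F t - G t) * (f t - g t))
      = F t * g t + f t * G t" for t
    by (simp add: algebra_simps)
qed

section \<open>The excess function\<close>

text \<open>With \<open>u = - \<integral> x\<^sup>2 dy\<close>, the set \<open>excess_fun e x u = 0\<close> implicitly defines the least excess \<open>e\<close> of length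
  over the increment of \<open>y\<close> with which a planar curve asymptotic to the line \<open>x = 0\<close> reaches
  \<open>(x, u)\<close>; it is found by eliminating the scale and the phase from the two-parameter family
  of rescaled Euler solitons.\<close>

definition excess_fun :: "real \<Rightarrow> real \<Rightarrow> real \<Rightarrow> real" where
  "excess_fun e x u = e^3 + 6 * x^2 * e - 24 * u - 3 * x^4 / e"

lemma excess_fun_strict_mono:
  assumes "0 < e" "e < e'"
  shows "excess_fun e x u < excess_fun e' x u"
proof -
  have "e^3 < e'^3" using assms by (intro power_strict_mono) auto
  moreover have "6 * x^2 * e \<le> 6 * x^2 * e'" using assms by (intro mult_left_mono) auto
  moreover have "3 * x^4 / e' \<le> 3 * x^4 / e" using assms by (intro divide_left_mono) auto
  ultimately show ?thesis by (simp add: excess_fun_def)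
qed

lemma le_sqrt_sum_squares: "b \<le> sqrt (a^2 + b^2)" for a b :: real
  by (rule real_le_rsqrt) simp

text \<open>The Hamilton--Jacobi inequality for the implicitly defined function, a Cauchy--Schwarz
  estimate because
  \<open>(4 x e (e\<^sup>2 - x\<^sup>2))\<^sup>2 + (8 x\<^sup>2 e\<^sup>2 - (e\<^sup>2 + x\<^sup>2)\<^sup>2)\<^sup>2 = (e\<^sup>2 + x\<^sup>2)\<^sup>4\<close>.\<close>

lemma excess_fun_rate_nonneg:
  fixes e x a b :: real
  assumes "e > 0"
  shows "0 \<le> 3 * (e^2 + x^2)^2 / e^2 * (sqrt (a^2 + b^2) - b) + 12 * x * (e^2 - x^2) / e * a + 24 * x^2 * b"
proof -
  define S P Q where "S = (e^2 + x^2)^2" and "P = 4 * x * e * (e^2 - x^2)"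
    and "Q = 8 * x^2 * e^2 - (e^2 + x^2)^2"
  have "S^2 = P^2 + Q^2"
    unfolding S_def P_def Q_def by algebra
  moreover have "S \<ge> 0" by (simp add: S_def)
  ultimately have S: "S = sqrt (P^2 + Q^2)"
    by (simp add: real_sqrt_unique)
  have "- (P * a + Q * b) \<le> \<bar>P * a + Q * b\<bar>" by simp
  also have "\<dots> \<le> sqrt ((P^2 + Q^2) * (a^2 + b^2))"
  proof (rule real_le_rsqrt)
    have "(P^2 + Q^2) * (a^2 + b^2) = (P * a + Q * b)^2 + (P * b - Q * a)^2"
      by algebra
    then show "\<bar>P * a + Q * b\<bar>^2 \<le> (P^2 + Q^2) * (a^2 + b^2)"
      by simp
  qed
  also have "\<dots> = S * sqrt (a^2 + b^2)"
    by (simp add: S real_sqrt_mult)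
  \<comment> \<open>After multiplication by 3/e^2, the term with \<open>P\<close> becomes the
    coefficient of \<open>a\<close>, while the term with \<open>Q\<close> splits into 24 x^2 b and
    the -b that accompanies the square root.\<close>
  finally have "0 \<le> 3 / e^2 * (S * sqrt (a^2 + b^2) + P * a + Q * b)"
    by (intro mult_nonneg_nonneg) auto
  also have "\<dots> = 3 * (e^2 + x^2)^2 / e^2 * (sqrt (a^2 + b^2) - b) + 12 * x * (e^2 - x^2) / e * a + 24 * x^2 * b"
  proof -
    define N where "N = sqrt (a^2 + b^2)"
    show ?thesis
      unfolding N_def[symmetric] S_def P_def Q_def using assms
      by (simp add: field_simps power2_eq_square)
  qed
  finally show ?thesis .
qed

text \<open>The excess never decreases, since length dominates the increment of y; it stays positive
  and 1/e makes sense throughout. The partial derivatives of \<open>excess_fun\<close> in e, x, u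
  are 3 (e^2 + x^2)^2 / e^2, 12 x (e^2 - x^2) / e and -24, so its rate is the expression in
  \<open>excess_fun_rate_nonneg\<close>.\<close>

lemma excess_fun_along_curve:
  assumes X: "bounded_primitive T X a"
    and U: "bounded_primitive T U (\<lambda>t. - (X t ^ 2 * b t))"
    and e: "bounded_primitive T e (\<lambda>t. sqrt (a t ^ 2 + b t ^ 2) - b t)"
    and "e 0 > 0" "0 \<le> T"
  shows "e T > 0" "excess_fun (e 0) (X 0) (U 0) \<le> excess_fun (e T) (X T) (U T)"
proof -
  define e' where "e' = (\<lambda>t. sqrt (a t ^ 2 + b t ^ 2) - b t)"
  have epos: "e t > 0" if "t \<in> {0..T}" for t
    using bounded_primitive_mono[OF e, of 0 t] that \<open>e 0 > 0\<close> by (simp add: le_sqrt_sum_squares)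
  then show "e T > 0" using \<open>0 \<le> T\<close> by simp
  \<comment> \<open>The rate is spelled exactly as the sum, product, power and reciprocal rules
    produce it; it is collapsed only in the proof that it is nonnegative.\<close>
  define r where "r = (\<lambda>t. (of_nat 3 * e t ^ (3 - 1) * e' t
        + 6 * (X t ^ 2 * e' t + (of_nat 2 * X t ^ (2 - 1) * a t) * e t)
        - 24 * (- (X t ^ 2 * b t)))
      - 3 * (X t ^ 4 * (- 1 / e t ^ 2 * e' t) + (of_nat 4 * X t ^ (4 - 1) * a t) * (1 / e t)))"
  have "bounded_primitive T
      (\<lambda>t. (e t ^ 3 + 6 * (X t ^ 2 * e t) - 24 * U t) - 3 * (X t ^ 4 * (1 / e t))) r"
    unfolding r_def e'_def
    by (rule bounded_primitive_diff bounded_primitive_add bounded_primitive_cmult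
        bounded_primitive_mult bounded_primitive_power bounded_primitive_inverse X U e
      | simp add: epos less_imp_neq[symmetric])+
  moreover have "r t \<ge> 0" if "t \<in> {0..T}" for t
  proof -
    have "r t = 3 * (e t ^ 2 + X t ^ 2)^2 / e t ^ 2 * e' t + 12 * X t * (e t ^ 2 - X t ^ 2) / e t * a t
        + 24 * X t ^ 2 * b t"
      using epos[OF that] unfolding r_def
      by (simp add: field_simps power2_eq_square power3_eq_cube power4_eq_xxxx)
    then show ?thesis
      using excess_fun_rate_nonneg[OF epos[OF that], of "X t" "a t" "b t"] by (simp add: e'_def)
  qed
  ultimately have "(e 0 ^ 3 + 6 * (X 0 ^ 2 * e 0) - 24 * U 0) - 3 * (X 0 ^ 4 * (1 / e 0))
      \<le> (e T ^ 3 + 6 * (X T ^ 2 * e T) - 24 * U T) - 3 * (X T ^ 4 * (1 / e T))"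
    using bounded_primitive_mono[of T _ r 0 T] \<open>0 \<le> T\<close> by blast
  then show "excess_fun (e 0) (X 0) (U 0) \<le> excess_fun (e T) (X T) (U T)"
    by (simp add: excess_fun_def mult.assoc)
qed

section \<open>Calibration of the Cartan group\<close>

text \<open>A coordinate projection is bounded linear and commutes with the integral, so the vector
  equation splits into five scalar primitives with bounded measurable rates.\<close>

lemma admissible_coordinates:
  assumes adm: "admissible T h v1 v2"
  obtains x y z v w where "\<And>t. h t = (x t, y t, z t, v t, w t)"
    "bounded_primitive T x v1" "bounded_primitive T y v2"
    "bounded_primitive T z (\<lambda>t. x t / 2 * v2 t + - y t / 2 * v1 t)"
    "bounded_primitive T v (\<lambda>t. (x t ^ 2 + y t ^ 2) / 2 * v2 t)"
    "bounded_primitive T w (\<lambda>t. - (x t ^ 2 + y t ^ 2) / 2 * v1 t)"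
proof -
  define V where "V = (\<lambda>s. v1 s *\<^sub>R X1 (h s) + v2 s *\<^sub>R X2 (h s))"
  define x y z v w where "x = (\<lambda>t. fst (h t))" and "y = (\<lambda>t. fst (snd (h t)))"
    and "z = (\<lambda>t. fst (snd (snd (h t))))" and "v = (\<lambda>t. fst (snd (snd (snd (h t)))))"
    and "w = (\<lambda>t. snd (snd (snd (snd (h t)))))"
  have h: "h t = (x t, y t, z t, v t, w t)" for t
    by (simp add: x_def y_def z_def v_def w_def)
  have V: "V t = (v1 t, v2 t, x t / 2 * v2 t + - y t / 2 * v1 t,
      (x t ^ 2 + y t ^ 2) / 2 * v2 t, - (x t ^ 2 + y t ^ 2) / 2 * v1 t)" for t
    by (simp add: V_def h X1_def X2_def algebra_simps)
  have v12: "bounded_measurable T v1" "bounded_measurable T v2"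
    using adm by (auto simp: admissible_def bounded_measurable_def measurable_on_iff_borel_measurable)
  have "continuous_on {0..T} h"
    using adm by (simp add: admissible_def)
  then have "continuous_on {0..T} x" "continuous_on {0..T} y"
    unfolding x_def y_def by (auto intro!: continuous_intros)
  then have coeff: "bounded_measurable T (\<lambda>t. x t / 2)" "bounded_measurable T (\<lambda>t. - y t / 2)"
    "bounded_measurable T (\<lambda>t. (x t ^ 2 + y t ^ 2) / 2)"
    "bounded_measurable T (\<lambda>t. - (x t ^ 2 + y t ^ 2) / 2)"
    by (auto intro!: bounded_measurable_continuous continuous_intros)
  have hV: "(V has_integral h t - h 0) {0..t}" if t: "t \<in> {0..T}" for t
  proof -
    have "V integrable_on {0..t}"
      by (rule integrable_on_subinterval[of V "{0..T}"])
        (use adm t in \<open>auto simp: admissible_def V_def\<close>)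
    moreover have "\<forall>t\<in>{0..T}. h t = h 0 + integral {0..t} V"
      using adm unfolding admissible_def V_def by blast
    with t have "integral {0..t} V = h t - h 0"
      by (metis add_diff_cancel_left')
    ultimately show ?thesis
      by (metis integrable_integral)
  qed
  have proj: "bounded_primitive T (\<lambda>t. \<pi> (h t)) f"
    if "bounded_linear \<pi>" "\<And>t. \<pi> (V t) = f t" "bounded_measurable T f" for \<pi> f
    unfolding bounded_primitive_def
    using has_integral_linear[OF hV that(1)] that by (simp add: o_def linear_diff bounded_linear.linear)
  note lin = bounded_linear_fst bounded_linear_snd
    bounded_linear_compose[OF bounded_linear_fst] bounded_linear_compose[OF bounded_linear_snd]
  show thesis
  proof (rule that[OF h])
    show "bounded_primitive T x v1" unfolding x_def
      by (rule proj[of "\<lambda>p. fst p"], intro lin, simp add: V, rule v12)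
    show "bounded_primitive T y v2" unfolding y_def
      by (rule proj[of "\<lambda>p. fst (snd p)"], intro lin, simp add: V, rule v12)
    show "bounded_primitive T z (\<lambda>t. x t / 2 * v2 t + - y t / 2 * v1 t)"
      by (subst z_def, rule proj[of "\<lambda>p. fst (snd (snd p))"], intro lin, simp add: V,
          intro bounded_measurable_add bounded_measurable_mult coeff v12)
    show "bounded_primitive T v (\<lambda>t. (x t ^ 2 + y t ^ 2) / 2 * v2 t)"
      by (subst v_def, rule proj[of "\<lambda>p. fst (snd (snd (snd p)))"], intro lin, simp add: V,
          intro bounded_measurable_mult coeff v12)
    show "bounded_primitive T w (\<lambda>t. - (x t ^ 2 + y t ^ 2) / 2 * v1 t)"
      by (subst w_def, rule proj[of "\<lambda>p. snd (snd (snd (snd p)))"], intro lin, simp add: V,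
          intro bounded_measurable_mult coeff v12)
  qed
qed

text \<open>On an extremal with \<open>\<alpha> = 4 k\<^sup>2\<close> the curvature is the affine function \<open>4 k * cal_x k \<beta> q\<close> of the
  point, with \<open>4 k q\<close> its initial value; \<open>cal_x\<close> and \<open>cal_y\<close> are the resulting planar coordinates
  rescaled by \<open>k\<close>, in which the planar projection is asymptotic to \<open>cal_x = 0\<close>. The group
  coordinates provide \<open>\<integral> \<eta> d\<xi> = \<xi> \<eta> / 2 - z\<close> and
  \<open>\<integral> \<eta>\<^sup>2 d\<xi> = 2 (v sin \<beta> - w cos \<beta>) - \<xi>\<^sup>3 / 3\<close>, which make
  \<open>cal_u = u - \<integral> cal_x\<^sup>2 d cal_y\<close> a function of the point.\<close>

definition cal_x :: "real \<Rightarrow> real \<Rightarrow> real \<Rightarrow> pt \<Rightarrow> real" where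
  "cal_x k \<beta> q p = (case p of (x,y,z,v,w) \<Rightarrow> q - k * (cos \<beta> * y - sin \<beta> * x))"

definition cal_y :: "real \<Rightarrow> real \<Rightarrow> pt \<Rightarrow> real" where
  "cal_y k \<beta> p = (case p of (x,y,z,v,w) \<Rightarrow> - k * (cos \<beta> * x + sin \<beta> * y))"

definition cal_u :: "real \<Rightarrow> real \<Rightarrow> real \<Rightarrow> real \<Rightarrow> pt \<Rightarrow> real" where
  "cal_u k \<beta> q u p = (case p of (x,y,z,v,w) \<Rightarrow>
     let \<xi> = cos \<beta> * x + sin \<beta> * y; \<eta> = cos \<beta> * y - sin \<beta> * x
     in u + k * (q^2 * \<xi> - 2 * q * k * (1/2 * (\<xi> * \<eta>) - z)
          + k^2 * (2 * (sin \<beta> * v - cos \<beta> * w) - 1/3 * \<xi>^3)))"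

lemma cal_at_0: "cal_x k \<beta> q 0 = q" "cal_y k \<beta> 0 = 0" "cal_u k \<beta> q u 0 = u"
  by (simp_all add: cal_x_def cal_y_def cal_u_def zero_prod_def)

lemma bounded_primitive_cal:
  assumes adm: "admissible T h v1 v2"
  shows "bounded_primitive T (\<lambda>t. cal_x k \<beta> q (h t)) (\<lambda>t. - k * (cos \<beta> * v2 t - sin \<beta> * v1 t))"
    and "bounded_primitive T (\<lambda>t. cal_y k \<beta> (h t)) (\<lambda>t. - k * (cos \<beta> * v1 t + sin \<beta> * v2 t))"
    and "bounded_primitive T (\<lambda>t. cal_u k \<beta> q u (h t))
      (\<lambda>t. - (cal_x k \<beta> q (h t) ^ 2 * (- k * (cos \<beta> * v1 t + sin \<beta> * v2 t))))"
proof -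
  obtain x y z v w where h: "\<And>t. h t = (x t, y t, z t, v t, w t)"
    and x: "bounded_primitive T x v1" and y: "bounded_primitive T y v2"
    and z: "bounded_primitive T z (\<lambda>t. x t / 2 * v2 t + - y t / 2 * v1 t)"
    and v: "bounded_primitive T v (\<lambda>t. (x t ^ 2 + y t ^ 2) / 2 * v2 t)"
    and w: "bounded_primitive T w (\<lambda>t. - (x t ^ 2 + y t ^ 2) / 2 * v1 t)"
    by (rule admissible_coordinates[OF adm]) (rule that)
  define \<xi> \<eta> \<xi>' \<eta>' where "\<xi> = (\<lambda>t. cos \<beta> * x t + sin \<beta> * y t)"
    and "\<eta> = (\<lambda>t. cos \<beta> * y t - sin \<beta> * x t)"
    and "\<xi>' = (\<lambda>t. cos \<beta> * v1 t + sin \<beta> * v2 t)"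
    and "\<eta>' = (\<lambda>t. cos \<beta> * v2 t - sin \<beta> * v1 t)"
  have \<xi>: "bounded_primitive T \<xi> \<xi>'"
    unfolding \<xi>_def \<xi>'_def by (intro bounded_primitive_add bounded_primitive_cmult x y)
  have \<eta>: "bounded_primitive T \<eta> \<eta>'"
    unfolding \<eta>_def \<eta>'_def by (intro bounded_primitive_diff bounded_primitive_cmult x y)
  have X: "cal_x k \<beta> q (h t) = q - k * \<eta> t" for t
    by (simp add: cal_x_def h \<eta>_def)
  show "bounded_primitive T (\<lambda>t. cal_x k \<beta> q (h t)) (\<lambda>t. - k * (cos \<beta> * v2 t - sin \<beta> * v1 t))"
    using bounded_primitive_diff[OF bounded_primitive_const[of T q] bounded_primitive_cmult[OF \<eta>, of k]]
    by (simp add: X \<eta>'_def)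
  show "bounded_primitive T (\<lambda>t. cal_y k \<beta> (h t)) (\<lambda>t. - k * (cos \<beta> * v1 t + sin \<beta> * v2 t))"
    using bounded_primitive_cmult[OF \<xi>, of "- k"] by (simp add: cal_y_def h \<xi>_def \<xi>'_def)
  show "bounded_primitive T (\<lambda>t. cal_u k \<beta> q u (h t))
      (\<lambda>t. - (cal_x k \<beta> q (h t) ^ 2 * (- k * (cos \<beta> * v1 t + sin \<beta> * v2 t))))"
  proof (rule bounded_primitive_cong)
    show "bounded_primitive T
       (\<lambda>t. u + k * (q^2 * \<xi> t - 2 * q * k * (1/2 * (\<xi> t * \<eta> t) - z t)
          + k^2 * (2 * (sin \<beta> * v t - cos \<beta> * w t) - 1/3 * \<xi> t ^ 3)))
       (\<lambda>t. 0 + k * (q^2 * \<xi>' t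
          - 2 * q * k * (1/2 * (\<xi> t * \<eta>' t + \<xi>' t * \<eta> t) - (x t / 2 * v2 t + - y t / 2 * v1 t))
          + k^2 * (2 * (sin \<beta> * ((x t ^ 2 + y t ^ 2) / 2 * v2 t)
                - cos \<beta> * (- (x t ^ 2 + y t ^ 2) / 2 * v1 t))
            - 1/3 * (of_nat 3 * \<xi> t ^ (3 - 1) * \<xi>' t))))"
      by (rule bounded_primitive_const bounded_primitive_add bounded_primitive_diff
          bounded_primitive_cmult bounded_primitive_power bounded_primitive_mult \<xi> \<eta> z v w)+
    show "u + k * (q^2 * \<xi> t - 2 * q * k * (1/2 * (\<xi> t * \<eta> t) - z t)
          + k^2 * (2 * (sin \<beta> * v t - cos \<beta> * w t) - 1/3 * \<xi> t ^ 3))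
        = cal_u k \<beta> q u (h t)" for t
      by (simp add: cal_u_def h \<xi>_def \<eta>_def Let_def)
    fix t
    \<comment> \<open>Rotation by \<beta> preserves the squared radius and the area form, so the
      rates of z, v, w can be expressed through the rotated coordinates.\<close>
    have rot: "x t ^ 2 + y t ^ 2 = \<xi> t ^ 2 + \<eta> t ^ 2"
      using sin_cos_squared_add[of \<beta>] unfolding \<xi>_def \<eta>_def by algebra
    have area: "x t / 2 * v2 t + - y t / 2 * v1 t = 1/2 * (\<xi> t * \<eta>' t - \<eta> t * \<xi>' t)"
    proof -
      have "x t * v2 t - y t * v1 t = \<xi> t * \<eta>' t - \<eta> t * \<xi>' t"
        using sin_cos_squared_add[of \<beta>] unfolding \<xi>_def \<eta>_def \<xi>'_def \<eta>'_def by algebra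
      then show ?thesis by simp
    qed
    have moment: "2 * (sin \<beta> * ((\<xi> t ^ 2 + \<eta> t ^ 2) / 2 * v2 t)
        - cos \<beta> * (- (\<xi> t ^ 2 + \<eta> t ^ 2) / 2 * v1 t)) = (\<xi> t ^ 2 + \<eta> t ^ 2) * \<xi>' t"
      by (simp add: \<xi>'_def field_simps)
    have vel: "cos \<beta> * v1 t + sin \<beta> * v2 t = \<xi>' t"
      by (simp add: \<xi>'_def)
    \<comment> \<open>The three groups have rates q^2 \<xi>', -2 q k \<eta> \<xi>' and k^2 \<eta>^2
      \<xi>', which complete the square (q - k \<eta>)^2 \<xi>'.\<close>
    show "0 + k * (q^2 * \<xi>' t
          - 2 * q * k * (1/2 * (\<xi> t * \<eta>' t + \<xi>' t * \<eta> t) - (x t / 2 * v2 t + - y t / 2 * v1 t))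
          + k^2 * (2 * (sin \<beta> * ((x t ^ 2 + y t ^ 2) / 2 * v2 t)
                - cos \<beta> * (- (x t ^ 2 + y t ^ 2) / 2 * v1 t))
            - 1/3 * (of_nat 3 * \<xi> t ^ (3 - 1) * \<xi>' t)))
        = - (cal_x k \<beta> q (h t) ^ 2 * (- k * (cos \<beta> * v1 t + sin \<beta> * v2 t)))"
      unfolding area rot moment X vel
      by (simp add: algebra_simps power2_eq_square)
  qed
qed

text \<open>The planar change of coordinates is an isometry scaled by \<open>k\<close>, so
  \<open>k\<close> times the length minus the increment of \<open>cal_y\<close> is the growth of the
  excess. The starting excess \<open>e0\<close> and the constants \<open>q\<close>, \<open>u\<close>
  remain free, to be matched to the soliton.\<close>

lemma calibration_along_curve:
  fixes k \<beta> e0 :: real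
  assumes adm: "admissible T h v1 v2" and "h 0 = 0" "k > 0" "e0 > 0"
  defines "e \<equiv> e0 + k * sr_length T v1 v2 - cal_y k \<beta> (h T)"
  shows "e > 0" "excess_fun e0 q u \<le> excess_fun e (cal_x k \<beta> q (h T)) (cal_u k \<beta> q u (h T))"
proof -
  define a b where "a = (\<lambda>t. - k * (cos \<beta> * v2 t - sin \<beta> * v1 t))"
    and "b = (\<lambda>t. - k * (cos \<beta> * v1 t + sin \<beta> * v2 t))"
  define \<nu> where "\<nu> = (\<lambda>t. sqrt (v1 t ^ 2 + v2 t ^ 2))"
  define E where "E = (\<lambda>t. e0 + k * integral {0..t} \<nu> - cal_y k \<beta> (h t))"
  have "0 \<le> T" using adm by (simp add: admissible_def)
  have ab: "sqrt (a t ^ 2 + b t ^ 2) = k * \<nu> t" for t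
  proof -
    have "a t ^ 2 + b t ^ 2 = k^2 * (v1 t ^ 2 + v2 t ^ 2)"
      using sin_cos_squared_add[of \<beta>] unfolding a_def b_def by algebra
    then show ?thesis
      using \<open>k > 0\<close> by (simp add: real_sqrt_mult \<nu>_def)
  qed
  have "bounded_measurable T \<nu>"
  proof -
    have v: "bounded_measurable T v1" "bounded_measurable T v2"
      using adm by (auto simp: admissible_def bounded_measurable_def measurable_on_iff_borel_measurable)
    then obtain M N where M: "\<And>t. t \<in> {0..T} \<Longrightarrow> \<bar>v1 t\<bar> \<le> M" and N: "\<And>t. t \<in> {0..T} \<Longrightarrow> \<bar>v2 t\<bar> \<le> N"
      by (metis bounded_measurable_obtain)
    show ?thesis
    proof (rule bounded_measurableI[where M = "M + N"])
      show "\<nu> \<in> borel_measurable (lebesgue_on {0..T})"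
        using v unfolding \<nu>_def bounded_measurable_def
        by (auto intro!: borel_measurable_sqrt borel_measurable_add borel_measurable_power)
      show "\<bar>\<nu> t\<bar> \<le> M + N" if "t \<in> {0..T}" for t
        using sqrt_sum_squares_le_sum_abs[of "v1 t" "v2 t"] M[OF that] N[OF that]
        by (simp add: \<nu>_def)
    qed
  qed
  then have "bounded_primitive T E (\<lambda>t. 0 + k * \<nu> t - b t)"
    unfolding E_def b_def
    by (intro bounded_primitive_diff bounded_primitive_add bounded_primitive_const
        bounded_primitive_cmult bounded_primitive_integral bounded_primitive_cal(2)[OF adm])
  then have E: "bounded_primitive T E (\<lambda>t. sqrt (a t ^ 2 + b t ^ 2) - b t)"
    by (simp add: ab)
  have X: "bounded_primitive T (\<lambda>t. cal_x k \<beta> q (h t)) a"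
    unfolding a_def by (rule bounded_primitive_cal(1)[OF adm])
  have U: "bounded_primitive T (\<lambda>t. cal_u k \<beta> q u (h t)) (\<lambda>t. - (cal_x k \<beta> q (h t) ^ 2 * b t))"
    unfolding b_def by (rule bounded_primitive_cal(3)[OF adm])
  have "E 0 = e0" "E T = e"
    by (simp_all add: E_def e_def \<open>h 0 = 0\<close> cal_at_0 sr_length_def \<nu>_def)
  with excess_fun_along_curve[OF X U E] \<open>e0 > 0\<close> \<open>0 \<le> T\<close>
  show "e > 0" "excess_fun e0 q u \<le> excess_fun e (cal_x k \<beta> q (h T)) (cal_u k \<beta> q u (h T))"
    by (auto simp: \<open>h 0 = 0\<close> cal_at_0)
qed

section \<open>The soliton\<close>

lemma extremal_admissible:
  assumes ext: "extremal \<theta> c \<alpha> \<beta> th cc g" and "0 \<le> T"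
  shows "admissible T g (\<lambda>s. cos (th s)) (\<lambda>s. sin (th s))"
proof -
  define V where "V = (\<lambda>s. cos (th s) *\<^sub>R X1 (g s) + sin (th s) *\<^sub>R X2 (g s))"
  have th: "continuous_on A th" for A
    using ext unfolding extremal_def
    by (meson DERIV_continuous continuous_at_imp_continuous_on)
  have deriv: "(g has_vector_derivative V t) (at t)" for t
    using ext by (simp add: extremal_def V_def)
  then have "continuous_on {0..T} g"
    by (meson continuous_at_imp_continuous_on has_vector_derivative_continuous)
  moreover have V: "(V has_integral g t - g 0) {0..t}" if "0 \<le> t" for t
    using that deriv
    by (intro fundamental_theorem_of_calculus) (auto intro: has_vector_derivative_at_within)
  moreover have "integral {0..t} V = g t - g 0" if "0 \<le> t" for t
    using V[OF that] by (rule integral_unique)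
  ultimately show ?thesis
    using \<open>0 \<le> T\<close> V[OF \<open>0 \<le> T\<close>]
    unfolding admissible_def V_def[symmetric]
    by (auto simp: measurable_on_iff_borel_measurable bounded_iff intro!: exI[of _ 1]
        continuous_imp_measurable_on_sets_lebesgue continuous_intros th)
qed

lemma sr_length_unit_speed: "0 \<le> T \<Longrightarrow> sr_length T (\<lambda>s. cos (th s)) (\<lambda>s. sin (th s)) = T"
  by (simp add: sr_length_def)

text \<open>At energy \<alpha> the half-angle formula makes c^2 a perfect square. The sign \<sigma>
  is chosen at time 0 and persists by uniqueness for a linear differential equation.\<close>

lemma C3_curvature:
  assumes C3: "in_C3 \<theta> c \<alpha> \<beta>" and ext: "extremal \<theta> c \<alpha> \<beta> th cc g"
  obtains k \<sigma> where "k > 0" "\<sigma>^2 = 1" "\<bar>sin ((\<theta> - \<beta>) / 2)\<bar> < 1"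
    "\<And>t. 0 \<le> t \<Longrightarrow> cc t = 4 * k * \<sigma> * cos ((th t - \<beta>) / 2)"
proof -
  define k where "k = sqrt \<alpha> / 2"
  have k: "k > 0" "\<alpha> = 4 * k^2"
    using C3 by (auto simp: in_C3_def k_def power_divide)
  have cos2: "cos (\<theta> - \<beta>) = 2 * cos ((\<theta> - \<beta>) / 2)^2 - 1"
    by (metis cos_double_cos field_sum_of_halves mult_2)
  have "c^2 / 2 - \<alpha> * cos (\<theta> - \<beta>) = \<alpha>"
    using C3 by (simp add: in_C3_def)
  then have "c^2 = (4 * k * cos ((\<theta> - \<beta>) / 2))^2"
    unfolding k(2) cos2 by (simp add: power2_eq_square algebra_simps)
  then have "c = 4 * k * cos ((\<theta> - \<beta>) / 2) \<or> c = - (4 * k * cos ((\<theta> - \<beta>) / 2))"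
    by (simp add: power2_eq_iff)
  then obtain \<sigma> :: real where \<sigma>: "\<sigma>^2 = 1" "c = 4 * k * \<sigma> * cos ((\<theta> - \<beta>) / 2)"
  proof
    assume "c = 4 * k * cos ((\<theta> - \<beta>) / 2)"
    then show ?thesis by (intro that[of 1]) auto
  next
    assume "c = - (4 * k * cos ((\<theta> - \<beta>) / 2))"
    then show ?thesis by (intro that[of "-1"]) auto
  qed
  \<comment> \<open>A zero here is precisely the excluded case \<theta> - \<beta> = pi modulo 2 pi.
    Excluding it gives the strict bound on the sine, hence a positive initial excess.\<close>
  have "cos ((\<theta> - \<beta>) / 2) \<noteq> 0"
  proof
    assume "cos ((\<theta> - \<beta>) / 2) = 0"
    then have "sin ((\<theta> - \<beta>) / 2 - pi / 2) = 0"
      by (simp add: sin_diff)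
    then obtain i :: int where "(\<theta> - \<beta>) / 2 - pi / 2 = of_int i * pi"
      by (auto simp: sin_zero_iff_int2)
    then have "\<theta> - \<beta> = pi + 2 * pi * of_int i"
      by (simp add: field_simps)
    with C3 show False by (simp add: in_C3_def)
  qed
  then have "sin ((\<theta> - \<beta>) / 2)^2 < 1^2"
    using sin_cos_squared_add[of "(\<theta> - \<beta>) / 2"] by (simp add: less_le sin_squared_eq)
  then have sin: "\<bar>sin ((\<theta> - \<beta>) / 2)\<bar> < 1"
    by (metis abs_square_less_1 power_one)
  define \<phi> where "\<phi> = (\<lambda>t. (th t - \<beta>) / 2)"
  define D where "D = (\<lambda>t. cc t - 4 * k * \<sigma> * cos (\<phi> t))"
  \<comment> \<open>The defect \<open>D\<close> satisfies a linear equation with coefficient at most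
    2k in absolute value, so this weight makes its square nonincreasing (Gronwall). Starting from 0,
    the defect vanishes for all nonnegative times.\<close>
  define m where "m = (\<lambda>t. D t ^ 2 * exp (- 4 * k * t))"
  have th: "(th has_real_derivative cc t) (at t)"
    and cc: "(cc has_real_derivative - \<alpha> * sin (th t - \<beta>)) (at t)" for t
    using ext by (auto simp: extremal_def)
  have \<phi>: "(\<phi> has_real_derivative cc t / 2) (at t)" for t
    unfolding \<phi>_def by (auto intro!: derivative_eq_intros th)
  have sin2: "sin (th t - \<beta>) = 2 * sin (\<phi> t) * cos (\<phi> t)" for t
    unfolding \<phi>_def by (metis sin_double field_sum_of_halves mult_2)
  have "(D has_real_derivative - \<alpha> * sin (th t - \<beta>) + 2 * k * \<sigma> * sin (\<phi> t) * cc t) (at t)" for t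
    unfolding D_def by (auto intro!: derivative_eq_intros cc \<phi>)
  moreover have "- \<alpha> * sin (th t - \<beta>) + 2 * k * \<sigma> * sin (\<phi> t) * cc t
      = 2 * k * \<sigma> * sin (\<phi> t) * D t" for t
    unfolding D_def k(2) sin2 using \<sigma>(1) by algebra
  ultimately have D: "(D has_real_derivative 2 * k * \<sigma> * sin (\<phi> t) * D t) (at t)" for t
    by simp
  have m: "(m has_real_derivative - (4 * k * (1 - \<sigma> * sin (\<phi> t)) * m t)) (at t)" for t
    unfolding m_def
    by (auto intro!: derivative_eq_intros D simp: power2_eq_square algebra_simps)
  have "D t = 0" if "0 \<le> t" for t
  proof -
    have "m t \<le> m 0"
    proof (rule DERIV_nonpos_imp_nonincreasing[OF that])
      fix r
      have "\<bar>\<sigma>\<bar> = 1" using \<sigma>(1) by (auto simp: power2_eq_1_iff)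
      then have "\<bar>\<sigma> * sin (\<phi> r)\<bar> \<le> 1"
        by (simp add: abs_mult)
      then have "0 \<le> 4 * k * (1 - \<sigma> * sin (\<phi> r)) * m r"
        using k(1) by (auto simp: m_def)
      with m show "\<exists>y. (m has_real_derivative y) (at r) \<and> y \<le> 0"
        by (metis neg_le_0_iff_le)
    qed
    also have "D 0 = 0"
      using ext \<sigma>(2) by (simp add: D_def \<phi>_def extremal_def)
    then have "m 0 = 0" by (simp add: m_def)
    finally show ?thesis
      by (simp add: m_def mult_le_0_iff)
  qed
  then show thesis
    using k(1) \<sigma>(1) sin by (intro that[of k \<sigma>]) (auto simp: D_def \<phi>_def)
qed

lemma C3_minimizing:
  assumes C3: "in_C3 \<theta> c \<alpha> \<beta>" and ext: "extremal \<theta> c \<alpha> \<beta> th cc g" and "0 \<le> T"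
  shows "minimizing g (\<lambda>s. cos (th s)) (\<lambda>s. sin (th s)) T"
proof -
  obtain k \<sigma> where "k > 0" "\<sigma>^2 = 1" and sin0: "\<bar>sin ((\<theta> - \<beta>) / 2)\<bar> < 1"
    and cc: "\<And>t. 0 \<le> t \<Longrightarrow> cc t = 4 * k * \<sigma> * cos ((th t - \<beta>) / 2)"
    by (rule C3_curvature[OF C3 ext]) (rule that)
  have adm: "admissible T g (\<lambda>s. cos (th s)) (\<lambda>s. sin (th s))"
    using ext \<open>0 \<le> T\<close> by (rule extremal_admissible)
  have th': "(th has_real_derivative cc t) (at t)" for t
    using ext by (simp add: extremal_def)
  have cont: "continuous_on A th" for A
    using th' by (meson DERIV_continuous continuous_at_imp_continuous_on)
  have at0: "g 0 = 0" "th 0 = \<theta>"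
    using ext by (auto simp: extremal_def)
  define \<phi> where "\<phi> = (\<lambda>t. (th t - \<beta>) / 2)"
  \<comment> \<open>This is a hyperbolic tangent profile: \<tau>' = 2k (1 - \<tau>^2). The excess
    along the soliton turns out to be 1 + \<tau>.\<close>
  define \<tau> where "\<tau> = (\<lambda>t. \<sigma> * sin (\<phi> t))"
  define q where "q = \<sigma> * cos (\<phi> 0)"
  \<comment> \<open>The constant 1/6 makes this polynomial vanish at \<tau> = -1, where the excess
    vanishes; with it \<open>excess_fun\<close> is zero all along the soliton.\<close>
  define \<upsilon> where "\<upsilon> = (\<lambda>t. \<tau> t / 2 - \<tau> t ^ 3 / 3 + 1 / 6)"
  have [continuous_intros]: "continuous_on A \<phi>" for A
    unfolding \<phi>_def by (intro continuous_intros cont) auto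
  have \<phi>: "(\<phi> has_real_derivative 2 * k * \<sigma> * cos (\<phi> t)) (at t)" if "t \<in> {0..T}" for t
    unfolding \<phi>_def using cc[of t] that by (auto intro!: derivative_eq_intros th')
  have \<tau>: "(\<tau> has_real_derivative 2 * k * cos (\<phi> t)^2) (at t)" if "t \<in> {0..T}" for t
    unfolding \<tau>_def using \<open>\<sigma>^2 = 1\<close>
    by (auto intro!: derivative_eq_intros \<phi>[OF that] simp: power2_eq_square)
  have pyth: "cos (\<phi> t)^2 = 1 - \<tau> t ^ 2" for t
    using \<open>\<sigma>^2 = 1\<close> by (simp add: \<tau>_def power_mult_distrib cos_squared_eq)
  have dir: "cos \<beta> * sin (th t) - sin \<beta> * cos (th t) = 2 * sin (\<phi> t) * cos (\<phi> t)"
    "cos \<beta> * cos (th t) + sin \<beta> * sin (th t) = 2 * cos (\<phi> t)^2 - 1" for t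
  proof -
    have "2 * \<phi> t = th t - \<beta>" by (simp add: \<phi>_def)
    then show "cos \<beta> * sin (th t) - sin \<beta> * cos (th t) = 2 * sin (\<phi> t) * cos (\<phi> t)"
      "cos \<beta> * cos (th t) + sin \<beta> * sin (th t) = 2 * cos (\<phi> t)^2 - 1"
      using sin_double[of "\<phi> t"] cos_double_cos[of "\<phi> t"] by (simp_all add: sin_diff cos_diff mult.commute)
  qed
  have x: "cal_x k \<beta> q (g t) = \<sigma> * cos (\<phi> t)" if "t \<in> {0..T}" for t
  proof (rule bounded_primitive_unique[OF bounded_primitive_cal(1)[OF adm] bounded_primitive_deriv _ _ that])
    show "((\<lambda>t. \<sigma> * cos (\<phi> t)) has_real_derivative - k * (2 * sin (\<phi> r) * cos (\<phi> r))) (at r)"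
      if "r \<in> {0..T}" for r
      using \<open>\<sigma>^2 = 1\<close> by (auto intro!: derivative_eq_intros \<phi>[OF that] simp: power2_eq_square)
    show "continuous_on {0..T} (\<lambda>r. - k * (2 * sin (\<phi> r) * cos (\<phi> r)))"
      by (intro continuous_intros)
  qed (simp_all only: dir at0 cal_at_0 q_def)
  have y: "cal_y k \<beta> (g t) = k * t - \<tau> t + \<tau> 0" if "t \<in> {0..T}" for t
  proof (rule bounded_primitive_unique[OF bounded_primitive_cal(2)[OF adm] bounded_primitive_deriv _ _ that])
    show "((\<lambda>t. k * t - \<tau> t + \<tau> 0) has_real_derivative - k * (2 * cos (\<phi> r)^2 - 1)) (at r)"
      if "r \<in> {0..T}" for r
      by (auto intro!: derivative_eq_intros \<tau>[OF that] simp: algebra_simps)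
    show "continuous_on {0..T} (\<lambda>r. - k * (2 * cos (\<phi> r)^2 - 1))"
      by (intro continuous_intros)
  qed (simp_all add: dir at0 cal_at_0)
  have u: "cal_u k \<beta> q (\<upsilon> 0) (g t) = \<upsilon> t" if "t \<in> {0..T}" for t
  proof (rule bounded_primitive_unique[OF bounded_primitive_cal(3)[OF adm] bounded_primitive_deriv _ _ that])
    show "(\<upsilon> has_real_derivative k * cos (\<phi> r)^2 * (2 * cos (\<phi> r)^2 - 1)) (at r)"
      if "r \<in> {0..T}" for r
      unfolding \<upsilon>_def
      by (rule derivative_eq_intros \<tau>[OF that] refl | simp)+ (simp add: pyth algebra_simps)
    show "continuous_on {0..T} (\<lambda>r. k * cos (\<phi> r)^2 * (2 * cos (\<phi> r)^2 - 1))"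
      by (intro continuous_intros)
  qed (simp_all add: dir at0 cal_at_0 x power_mult_distrib \<open>\<sigma>^2 = 1\<close>)
  have soliton: "excess_fun (1 + \<tau> t) (\<sigma> * cos (\<phi> t)) (\<upsilon> t) = 0" if "1 + \<tau> t > 0" for t
  proof -
    define X where "X = \<sigma> * cos (\<phi> t)"
    have X2: "X^2 = (1 - \<tau> t) * (1 + \<tau> t)"
      unfolding X_def using \<open>\<sigma>^2 = 1\<close> pyth[of t] by algebra
    have "3 * X^4 = 3 * (1 - \<tau> t)^2 * (1 + \<tau> t) * (1 + \<tau> t)"
      using X2 by algebra
    then have "3 * X^4 / (1 + \<tau> t) = 3 * (1 - \<tau> t)^2 * (1 + \<tau> t)"
      using that by simp
    then show ?thesis
      unfolding excess_fun_def \<upsilon>_def X_def[symmetric] X2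
      by (simp add: field_simps power2_eq_square power3_eq_cube)
  qed
  have "\<bar>\<sigma>\<bar> = 1"
    using \<open>\<sigma>^2 = 1\<close> by (auto simp: power2_eq_1_iff)
  then have "\<bar>\<tau> 0\<bar> < 1"
    using sin0 by (simp add: \<tau>_def \<phi>_def at0 abs_mult)
  then have \<tau>0: "1 + \<tau> 0 > 0" by simp
  \<comment> \<open>Monotonicity carries positivity of the excess to the final time, so
    \<open>soliton\<close> applies at both ends.\<close>
  have "\<tau> 0 \<le> \<tau> T"
    by (rule DERIV_nonneg_imp_nondecreasing[OF \<open>0 \<le> T\<close>])
      (use \<tau> \<open>k > 0\<close> in \<open>fastforce intro!: exI\<close>)
  with \<tau>0 have \<tau>T: "1 + \<tau> T > 0" by simp
  have "T \<le> sr_length T' v1 v2" if h: "admissible T' h v1 v2" "h 0 = g 0" "h T' = g T" for T' h v1 v2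
  proof -
    define e where "e = 1 + \<tau> 0 + k * sr_length T' v1 v2 - cal_y k \<beta> (g T)"
    have "h 0 = 0" using h at0 by simp
    note cal = calibration_along_curve[OF h(1) this \<open>k > 0\<close> \<tau>0, where \<beta> = \<beta>,
      unfolded h(3), folded e_def]
    have "excess_fun (1 + \<tau> 0) q (\<upsilon> 0) \<le> excess_fun e (cal_x k \<beta> q (g T)) (cal_u k \<beta> q (\<upsilon> 0) (g T))"
      by (rule cal)
    then have "excess_fun (1 + \<tau> T) (\<sigma> * cos (\<phi> T)) (\<upsilon> T) \<le> excess_fun e (\<sigma> * cos (\<phi> T)) (\<upsilon> T)"
      using soliton[OF \<tau>0] soliton[OF \<tau>T] x[of T] u[of T] \<open>0 \<le> T\<close> by (simp add: q_def)
    then have "1 + \<tau> T \<le> e"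
      using excess_fun_strict_mono[OF cal(1)] by (meson not_less)
    \<comment> \<open>By the formula for \<open>cal_y\<close> at the common endpoint,
      \<open>e\<close> equals 1 + \<tau>(T) + k (L - T), where L is the competitor's length.\<close>
    then have "k * T \<le> k * sr_length T' v1 v2"
      using y[of T] \<open>0 \<le> T\<close> by (simp add: e_def)
    then show ?thesis using \<open>k > 0\<close> by simp
  qed
  then show ?thesis
    using adm \<open>0 \<le> T\<close> by (auto simp: minimizing_def sr_length_unit_speed)
qed

section \<open>Cut and conjugate times from minimality on every interval\<close>

lemma Sup_ereal_positive_reals:
  assumes "\<And>t. 0 < t \<Longrightarrow> P t"
  shows "Sup {ereal t | t. 0 < t \<and> P t} = \<infinity>"
proof (rule ereal_top)
  fix B :: real
  have "ereal (max B 1) \<le> Sup {ereal t | t. 0 < t \<and> P t}"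
    using assms[of "max B 1"] by (intro Sup_upper CollectI exI[of _ "max B 1"]) simp
  then show "ereal B \<le> Sup {ereal t | t. 0 < t \<and> P t}"
    by (rule order_trans[rotated]) simp
qed

lemma minimizing_imp_locally_optimal:
  "minimizing g u1 u2 T \<Longrightarrow> locally_optimal g u1 u2 T"
  unfolding minimizing_def locally_optimal_def by (auto intro!: exI[of _ 1])

theorem theorem6p2:
  fixes \<theta> c \<alpha> \<beta> :: real and th cc :: "real \<Rightarrow> real" and g :: "real \<Rightarrow> pt"
  assumes "in_C3 \<theta> c \<alpha> \<beta>"
    and "extremal \<theta> c \<alpha> \<beta> th cc g"
  shows "t_cut th g = \<infinity> \<and> t_conj1 th g = \<infinity> \<and> t_MAX1 \<theta> c \<alpha> \<beta> = \<infinity>"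
proof -
  have "minimizing g (\<lambda>s. cos (th s)) (\<lambda>s. sin (th s)) t" if "0 < t" for t
    using C3_minimizing[OF assms] that by simp
  then show ?thesis
    using assms(1) minimizing_imp_locally_optimal
    unfolding t_cut_def t_conj1_def t_MAX1_def by (auto intro!: Sup_ereal_positive_reals)
qed

end
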